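(* Let $G=K_2$ (two vertices $1,2$ joined by an edge), let $\theta$ be a weight function with $\theta_{12}=\theta(p_1,p_2)$, and let $E$ be a smooth function of $(p_1,p_2)\in(0,\infty)^2$. Then for every $p=(p_1,p_2)$ with $p_1,p_2>0$, $p_1+p_2=1$, the local Ricci curvature bound at $p$ is $$\kappa=\frac12\left(\frac{\partial\theta_{12}}{\partial p_1}-\frac{\partial\theta_{12}}{\partial p_2}\right)\left(\frac{\partial E}{\partial p_1}-\frac{\partial E}{\partial p_2}\right)+\theta_{12}\left(\frac{\partial^2E}{\partial p_1^2}-2\frac{\partial^2E}{\partial p_1\partial p_2}+\frac{\partial^2E}{\partial p_2^2}\right).$$
   Context: A weight function is $\theta:[0,\infty)^2\to[0,\infty)$, continuous, $C^\infty$ on $(0,\infty)^2$, symmetric and positive on $(0,\infty)^2$. On a graph with weights $\theta_{ij}$ ($\theta_{ij}=0$ for non-edges and $i=j$), the geodesic equation is $\dot p_i=\sum_j(f_i-f_j)\theta_{ij}$, $\dot f_i=-\frac12\sum_j(f_i-f_j)^2\partial_{p_i}\theta_{ij}+h_i$; set $\Gamma_1(p,f,f)=\sum_{i,j}\theta_{ij}(f_i-f_j)^2$ and $\Gamma_2(p,f,f)=\frac{d^2}{dt^2}E(p(t))$ along a geodesic, where $h$ is taken orthogonal to $f$ and to $\nabla E$ in the sense $\sum_{i,j}\theta_{ij}(f_i-f_j)(h_i-h_j)=0=\sum_{i,j}\theta_{ij}(\partial_iE-\partial_jE)(h_i-h_j)$ (a geodesic is constant-speed iff the first orthogonality holds).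 The local Ricci curvature bound $\kappa(p)$ is the largest number such that $\Gamma_2(p,f,f)\ge\kappa(p)\Gamma_1(p,f,f)$ for all constant-speed geodesics passing through $p$.
   Formalization: The sum over i,j in Γ₁ (and in the orthogonality conditions) is taken over unordered pairs, each edge counted once; with ordered pairs Γ₁ doubles and the stated κ would be too large by a factor 2 (e.g. θ=1, E=p₁²). *)

theory Defs
  imports "HOL-Analysis.Analysis"
begin

text \<open>Smoothness on an open set, iterating the Frechet derivative.\<close>

primrec times_differentiable_on ::
  "nat \<Rightarrow> 'a::real_normed_vector set \<Rightarrow> ('a \<Rightarrow> real) \<Rightarrow> bool" where
  "times_differentiable_on 0 S f \<longleftrightarrow> continuous_on S f"
| "times_differentiable_on (Suc n) S f \<longleftrightarrow>
     (\<forall>x\<in>S. f differentiable (at x)) \<and>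
     (\<forall>v. times_differentiable_on n S (\<lambda>x. frechet_derivative f (at x) v))"

definition smooth_on :: "'a::real_normed_vector set \<Rightarrow> ('a \<Rightarrow> real) \<Rightarrow> bool" where
  "smooth_on S f \<longleftrightarrow> (\<forall>n. times_differentiable_on n S f)"

definition partial_deriv :: "'v::finite \<Rightarrow> ((real, 'v) vec \<Rightarrow> real) \<Rightarrow> (real, 'v) vec \<Rightarrow> real" where
  "partial_deriv i F p = deriv (\<lambda>s. F (p + s *\<^sub>R axis i 1)) 0"

definition gradient :: "((real, 'v::finite) vec \<Rightarrow> real) \<Rightarrow> (real, 'v) vec \<Rightarrow> (real, 'v) vec" where
  "gradient F p = (\<chi> i. partial_deriv i F p)"

definition weight_function :: "(real \<times> real \<Rightarrow> real) \<Rightarrow> bool" where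
  "weight_function \<theta> \<longleftrightarrow>
     (\<forall>x\<ge>0. \<forall>y\<ge>0. 0 \<le> \<theta> (x, y)) \<and>
     continuous_on ({0..} \<times> {0..}) \<theta> \<and>
     smooth_on ({0<..} \<times> {0<..}) \<theta> \<and>
     (\<forall>x>0. \<forall>y>0. \<theta> (x, y) = \<theta> (y, x)) \<and>
     (\<forall>x>0. \<forall>y>0. 0 < \<theta> (x, y))"

definition edge_weight ::
  "('v::finite \<Rightarrow> 'v \<Rightarrow> bool) \<Rightarrow> (real \<times> real \<Rightarrow> real) \<Rightarrow> 'v \<Rightarrow> 'v \<Rightarrow> (real, 'v) vec \<Rightarrow> real" where
  "edge_weight adj \<theta> i j p = (if i \<noteq> j \<and> adj i j then \<theta> (p $ i, p $ j) else 0)"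

text \<open>
  In all of the following, \<open>W i j p\<close> is the weight of the pair \<open>i, j\<close> at \<open>p\<close>
  and is meant to be symmetric in \<open>i\<close> and \<open>j\<close>.

  The sum in \<open>\<Gamma>\<^sub>1\<close> runs over unordered pairs, so every edge is counted once (the linear order on
  vertices only serves to pick one orientation). This is the normalisation for which
  \<open>\<Gamma>\<^sub>1(p, f, f) / 2\<close> is the Hamiltonian of the geodesic equation:
  \<open>p\<close>' is its derivative in \<open>f\<close>, and \<open>f\<close>' (for \<open>h = 0\<close>) minus its derivative in \<open>p\<close>.
\<close>

definition Gamma1 ::
  "('v::{finite,linorder} \<Rightarrow> 'v \<Rightarrow> (real, 'v) vec \<Rightarrow> real) \<Rightarrow> (real, 'v) vec \<Rightarrow> (real, 'v) vec \<Rightarrow> (real, 'v) vec \<Rightarrow> real" where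
  "Gamma1 W p f g = (\<Sum>(i, j) | i < j. W i j p * (f $ i - f $ j) * (g $ i - g $ j))"

definition geodesic_on ::
  "('v::{finite,linorder} \<Rightarrow> 'v \<Rightarrow> (real, 'v) vec \<Rightarrow> real) \<Rightarrow> real set \<Rightarrow>
   (real \<Rightarrow> (real, 'v) vec) \<Rightarrow> (real \<Rightarrow> (real, 'v) vec) \<Rightarrow> (real \<Rightarrow> (real, 'v) vec) \<Rightarrow> bool" where
  "geodesic_on W T p f h \<longleftrightarrow>
     open T \<and> is_interval T \<and>
     (\<forall>t\<in>T. (\<forall>i. 0 < p t $ i) \<and>
        (p has_vector_derivative
           (\<chi> i. \<Sum>j\<in>UNIV. (f t $ i - f t $ j) * W i j (p t))) (at t) \<and>
        (f has_vector_derivative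
           (\<chi> i. - (1/2) * (\<Sum>j\<in>UNIV. (f t $ i - f t $ j)\<^sup>2 * partial_deriv i (W i j) (p t))
                 + h t $ i)) (at t))"

definition constant_speed_on ::
  "('v::{finite,linorder} \<Rightarrow> 'v \<Rightarrow> (real, 'v) vec \<Rightarrow> real) \<Rightarrow> real set \<Rightarrow>
   (real \<Rightarrow> (real, 'v) vec) \<Rightarrow> (real \<Rightarrow> (real, 'v) vec) \<Rightarrow> bool" where
  "constant_speed_on W T p f \<longleftrightarrow>
     (\<forall>s\<in>T. \<forall>t\<in>T. Gamma1 W (p s) (f s) (f s) = Gamma1 W (p t) (f t) (f t))"

definition orthogonal_force_on ::
  "('v::{finite,linorder} \<Rightarrow> 'v \<Rightarrow> (real, 'v) vec \<Rightarrow> real) \<Rightarrow> ((real, 'v) vec \<Rightarrow> real) \<Rightarrow> real set \<Rightarrow>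
   (real \<Rightarrow> (real, 'v) vec) \<Rightarrow> (real \<Rightarrow> (real, 'v) vec) \<Rightarrow> (real \<Rightarrow> (real, 'v) vec) \<Rightarrow> bool" where
  "orthogonal_force_on W E T p f h \<longleftrightarrow>
     (\<forall>t\<in>T. Gamma1 W (p t) (f t) (h t) = 0 \<and> Gamma1 W (p t) (gradient E (p t)) (h t) = 0)"

text \<open>\<open>\<Gamma>\<^sub>2\<close> at time \<open>t\<close> of the geodesic with position curve \<open>p\<close>.\<close>

definition Gamma2 :: "((real, 'v::finite) vec \<Rightarrow> real) \<Rightarrow> (real \<Rightarrow> (real, 'v) vec) \<Rightarrow> real \<Rightarrow> real" where
  "Gamma2 E p t = deriv (deriv (\<lambda>s. E (p s))) t"

definition ricci_lower_bound ::
  "('v::{finite,linorder} \<Rightarrow> 'v \<Rightarrow> (real, 'v) vec \<Rightarrow> real) \<Rightarrow> ((real, 'v) vec \<Rightarrow> real) \<Rightarrow>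
   (real, 'v) vec \<Rightarrow> real \<Rightarrow> bool" where
  "ricci_lower_bound W E q k \<longleftrightarrow>
     (\<forall>T p f h t. geodesic_on W T p f h \<longrightarrow> constant_speed_on W T p f \<longrightarrow>
        orthogonal_force_on W E T p f h \<longrightarrow> t \<in> T \<longrightarrow> p t = q \<longrightarrow>
        Gamma2 E p t \<ge> k * Gamma1 W q (f t) (f t))"

definition is_local_ricci_bound ::
  "('v::{finite,linorder} \<Rightarrow> 'v \<Rightarrow> (real, 'v) vec \<Rightarrow> real) \<Rightarrow> ((real, 'v) vec \<Rightarrow> real) \<Rightarrow>
   (real, 'v) vec \<Rightarrow> real \<Rightarrow> bool" where
  "is_local_ricci_bound W E q \<kappa> \<longleftrightarrow>
     ricci_lower_bound W E q \<kappa> \<and> (\<forall>k. ricci_lower_bound W E q k \<longrightarrow> k \<le> \<kappa>)"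

text \<open>The vertices of \<open>K\<^sub>2\<close> are the elements 1 and 2 of the two-element type \<open>2\<close>.\<close>

definition K2_adj :: "2 \<Rightarrow> 2 \<Rightarrow> bool" where
  "K2_adj i j \<longleftrightarrow> i \<noteq> j"

definition K2_weight :: "(real \<times> real \<Rightarrow> real) \<Rightarrow> 2 \<Rightarrow> 2 \<Rightarrow> real ^ 2 \<Rightarrow> real" where
  "K2_weight \<theta> = edge_weight K2_adj \<theta>"

end

theory Submission
  imports Defs
begin

text \<open>
  On \<open>K\<^sub>2\<close> every geodesic moves along the fixed direction \<open>e\<^sub>1 - e\<^sub>2\<close>. Write \<open>D\<close> for the derivative in
  this direction, \<open>w = \<theta>\<^sub>1\<^sub>2(p)\<close> and \<open>u = f\<^sub>1 - f\<^sub>2\<close>. The geodesic equation becomes \<open>p' = u w (e\<^sub>1 - e\<^sub>2)\<close>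
  and \<open>u' = - u\<^sup>2 D w / 2 + (h\<^sub>1 - h\<^sub>2)\<close>, whence \<open>(u w)' = u\<^sup>2 w D w / 2 + w (h\<^sub>1 - h\<^sub>2)\<close> and
  \<open>\<Gamma>\<^sub>2 = (u w D E)' = u\<^sup>2 w (D w D E / 2 + w D D E) + w D E (h\<^sub>1 - h\<^sub>2)\<close>. The last term vanishes because
  \<open>h\<close> is orthogonal to the gradient of \<open>E\<close>, and \<open>u\<^sup>2 w = \<Gamma>\<^sub>1\<close>. So \<open>\<Gamma>\<^sub>2 = \<kappa> \<Gamma>\<^sub>1\<close> for every geodesic, and
  \<open>\<kappa>\<close> is optimal as soon as one geodesic through the given point has \<open>\<Gamma>\<^sub>1 > 0\<close>. One of unit speed is
  obtained by solving \<open>p' = sqrt w (e\<^sub>1 - e\<^sub>2)\<close>.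
\<close>

section \<open>Directional derivatives\<close>

definition directional_deriv :: "'a::real_normed_vector \<Rightarrow> ('a \<Rightarrow> real) \<Rightarrow> 'a \<Rightarrow> real" where
  "directional_deriv v f x = deriv (\<lambda>s. f (x + s *\<^sub>R v)) 0"

lemma partial_deriv_eq_directional_deriv: "partial_deriv i = directional_deriv (axis i 1)"
  by (simp add: fun_eq_iff partial_deriv_def directional_deriv_def)

lemma has_real_derivative_compose_curve:
  fixes f :: "'a::real_normed_vector \<Rightarrow> real"
  assumes "f differentiable (at (c t))" and "(c has_vector_derivative v) (at t)"
  shows "((\<lambda>s. f (c s)) has_real_derivative frechet_derivative f (at (c t)) v) (at t)"
  using vector_derivative_diff_chain_within[of c v t UNIV f] assms
  by (simp add: frechet_derivative_works has_real_derivative_iff_has_vector_derivative o_def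
      has_derivative_at_withinI)

lemma has_vector_derivative_line: "((\<lambda>s. x + s *\<^sub>R v) has_vector_derivative v) (at s)"
  by (auto intro!: derivative_eq_intros)

lemma directional_deriv_eq_frechet_derivative:
  assumes "f differentiable (at x)"
  shows "directional_deriv v f x = frechet_derivative f (at x) v"
  using has_real_derivative_compose_curve[OF _ has_vector_derivative_line, of f x 0 v] assms
  by (simp add: directional_deriv_def DERIV_imp_deriv)

lemma directional_deriv_scaleR:
  assumes "f differentiable (at x)"
  shows "directional_deriv (a *\<^sub>R v) f x = a * directional_deriv v f x"
  using linear_scale[OF linear_frechet_derivative[OF assms]] assms
  by (simp add: directional_deriv_eq_frechet_derivative)

lemma directional_deriv_diff_direction:
  assumes "f differentiable (at x)"
  shows "directional_deriv (u - v) f x = directional_deriv u f x - directional_deriv v f x"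
  using linear_diff[OF linear_frechet_derivative[OF assms]] assms
  by (simp add: directional_deriv_eq_frechet_derivative)

lemma has_real_derivative_along_curve:
  fixes f :: "'a::real_normed_vector \<Rightarrow> real"
  assumes "f differentiable (at (c t))" and "(c has_vector_derivative a *\<^sub>R v) (at t)"
  shows "((\<lambda>s. f (c s)) has_real_derivative a * directional_deriv v f (c t)) (at t)"
  using has_real_derivative_compose_curve[OF assms] assms(1)
  by (simp flip: directional_deriv_eq_frechet_derivative directional_deriv_scaleR)

lemma has_real_derivative_along_line:
  fixes f :: "'a::real_normed_vector \<Rightarrow> real"
  assumes "f differentiable (at (x + s *\<^sub>R v))"
  shows "((\<lambda>s. f (x + s *\<^sub>R v)) has_real_derivative directional_deriv v f (x + s *\<^sub>R v)) (at s)"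
  using has_real_derivative_along_curve[of f "\<lambda>s. x + s *\<^sub>R v" s 1 v] assms
  by (simp add: has_vector_derivative_line)

lemma directional_deriv_cong_open:
  assumes S: "open S" "x \<in> S" and eq: "\<And>y. y \<in> S \<Longrightarrow> f y = g y"
  shows "directional_deriv v f x = directional_deriv v g x"
  unfolding directional_deriv_def
proof (rule deriv_cong_ev)
  have "isCont (\<lambda>s. x + s *\<^sub>R v) 0"
    by (intro continuous_intros)
  then have "((\<lambda>s. x + s *\<^sub>R v) \<longlongrightarrow> x + 0 *\<^sub>R v) (nhds 0)"
    unfolding isCont_def by (rule tendsto_at_iff_tendsto_nhds[THEN iffD1])
  then have "\<forall>\<^sub>F s in nhds 0. x + s *\<^sub>R v \<in> S"
    by (rule topological_tendstoD) (simp_all add: S)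
  then show "\<forall>\<^sub>F s in nhds 0. f (x + s *\<^sub>R v) = g (x + s *\<^sub>R v)"
    by eventually_elim (rule eq)
qed simp

lemma differentiable_transform_within_open:
  assumes "f differentiable (at x)" and "open S" "x \<in> S" and "\<And>y. y \<in> S \<Longrightarrow> f y = g y"
  shows "g differentiable (at x)"
  using assms unfolding differentiable_def by (blast intro: has_derivative_transform_within_open)

lemma times_differentiable_on_cong:
  assumes S: "open S" and eq: "\<And>x. x \<in> S \<Longrightarrow> f x = g x" and f: "times_differentiable_on n S f"
  shows "times_differentiable_on n S g"
  using eq f
proof (induction n arbitrary: f g)
  case 0
  then show ?case
    by (simp cong: continuous_on_cong)
next
  case (Suc n)
  have f: "f differentiable (at x)" if "x \<in> S" for x
    using Suc.prems(2) that by simp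
  have frechet_eq: "frechet_derivative f (at x) = frechet_derivative g (at x)" if "x \<in> S" for x
    using f[OF that] S that Suc.prems(1) by (rule frechet_derivative_transform_within_open)
  have "times_differentiable_on n S (\<lambda>x. frechet_derivative g (at x) v)" for v
    by (rule Suc.IH[of "\<lambda>x. frechet_derivative f (at x) v"]) (use Suc.prems(2) frechet_eq in simp_all)
  moreover have "g differentiable (at x)" if "x \<in> S" for x
    using f[OF that] S that Suc.prems(1) by (rule differentiable_transform_within_open)
  ultimately show ?case
    by simp
qed

lemma times_differentiable_on_directional_deriv:
  assumes S: "open S" and f: "times_differentiable_on (Suc n) S f"
  shows "times_differentiable_on n S (directional_deriv v f)"
  by (rule times_differentiable_on_cong[OF S, of "\<lambda>x. frechet_derivative f (at x) v"])
    (use f in \<open>simp_all add: directional_deriv_eq_frechet_derivative\<close>)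

lemma times_differentiable_on_2_imp:
  assumes "times_differentiable_on 2 S f" "open S"
  shows "x \<in> S \<Longrightarrow> f differentiable (at x)"
    and "x \<in> S \<Longrightarrow> directional_deriv v f differentiable (at x)"
    and "continuous_on S (directional_deriv u (directional_deriv v f))"
  using assms times_differentiable_on_directional_deriv[of S 1 f v]
    times_differentiable_on_directional_deriv[of S 0 "directional_deriv v f" u]
  by (simp_all add: numeral_2_eq_2)

lemma mixed_difference_mean_value:
  fixes f :: "'a::real_normed_vector \<Rightarrow> real"
  assumes f: "times_differentiable_on 2 S f" "open S" and r: "0 < r"
    and S: "\<And>s t. 0 \<le> s \<Longrightarrow> s \<le> r \<Longrightarrow> 0 \<le> t \<Longrightarrow> t \<le> r \<Longrightarrow> x + s *\<^sub>R u + t *\<^sub>R v \<in> S"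
  obtains s t where "0 < s" "s < r" "0 < t" "t < r"
    "f (x + r *\<^sub>R u + r *\<^sub>R v) - f (x + r *\<^sub>R u) - f (x + r *\<^sub>R v) + f x =
       r\<^sup>2 * directional_deriv v (directional_deriv u f) (x + s *\<^sub>R u + t *\<^sub>R v)"
proof -
  let ?D = "directional_deriv u f"
  define g where "g s = f (x + r *\<^sub>R v + s *\<^sub>R u) - f (x + s *\<^sub>R u)" for s
  have "(g has_real_derivative ?D (x + r *\<^sub>R v + s *\<^sub>R u) - ?D (x + s *\<^sub>R u)) (at s)"
    if "0 \<le> s" "s \<le> r" for s
    unfolding g_def using S[of s r] S[of s 0] that r
    by (intro DERIV_diff has_real_derivative_along_line times_differentiable_on_2_imp(1)[OF f])
      (simp_all add: add_ac)
  from MVT2[OF r this] obtain s where s: "0 < s" "s < r"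
    and g_diff: "g r - g 0 = r * (?D (x + r *\<^sub>R v + s *\<^sub>R u) - ?D (x + s *\<^sub>R u))"
    by auto
  have "((\<lambda>t. ?D (x + s *\<^sub>R u + t *\<^sub>R v)) has_real_derivative
      directional_deriv v ?D (x + s *\<^sub>R u + t *\<^sub>R v)) (at t)" if "0 \<le> t" "t \<le> r" for t
    using S[of s t] s that
    by (intro has_real_derivative_along_line times_differentiable_on_2_imp(2)[OF f]) simp_all
  from MVT2[OF r this] obtain t where t: "0 < t" "t < r"
    and D_diff: "?D (x + s *\<^sub>R u + r *\<^sub>R v) - ?D (x + s *\<^sub>R u) =
      r * directional_deriv v ?D (x + s *\<^sub>R u + t *\<^sub>R v)"
    by auto
  show thesis
    using that[OF s t] g_diff D_diff by (simp add: g_def algebra_simps power2_eq_square)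
qed

lemma mixed_difference_quotient_tendsto:
  fixes f :: "'a::real_normed_vector \<Rightarrow> real"
  assumes f: "times_differentiable_on 2 S f" and S: "open S" "x \<in> S"
  shows "((\<lambda>r. (f (x + r *\<^sub>R u + r *\<^sub>R v) - f (x + r *\<^sub>R u) - f (x + r *\<^sub>R v) + f x) / r\<^sup>2)
    \<longlongrightarrow> directional_deriv v (directional_deriv u f) x) (at_right 0)"
proof (rule tendstoI)
  fix e :: real assume "e > 0"
  let ?H = "directional_deriv v (directional_deriv u f)"
  define c where "c z = x + fst z *\<^sub>R u + snd z *\<^sub>R v" for z :: "real \<times> real"
  have "isCont c 0"
    unfolding c_def by (intro continuous_intros)
  then have "(c \<longlongrightarrow> c 0) (nhds 0)"
    by (simp only: isCont_def tendsto_at_iff_tendsto_nhds)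
  then have "(c \<longlongrightarrow> x) (nhds 0)"
    by (simp add: c_def)
  moreover have "isCont ?H x"
    using times_differentiable_on_2_imp(3)[OF f S(1)] S by (simp add: continuous_on_eq_continuous_at)
  ultimately have "\<forall>\<^sub>F z in nhds 0. c z \<in> S" "\<forall>\<^sub>F z in nhds 0. dist (?H (c z)) (?H x) < e"
    using S \<open>e > 0\<close> by (auto intro: topological_tendstoD tendstoD isCont_tendsto_compose)
  then have "\<forall>\<^sub>F z in nhds 0. c z \<in> S \<and> dist (?H (c z)) (?H x) < e"
    by (rule eventually_conj)
  then obtain d where "d > 0" and d: "\<And>z. norm z < d \<Longrightarrow> c z \<in> S \<and> dist (?H (c z)) (?H x) < e"
    by (auto simp: eventually_nhds_metric)
  have near: "x + s *\<^sub>R u + t *\<^sub>R v \<in> S \<and> dist (?H (x + s *\<^sub>R u + t *\<^sub>R v)) (?H x) < e"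
    if "0 \<le> s" "s \<le> r" "0 \<le> t" "t \<le> r" "r < d / 2" for r s t
    using d[of "(s, t)"] norm_Pair_le[of s t] that by (simp add: c_def)
  have "\<forall>\<^sub>F r in at_right 0. 0 < r \<and> r < d / 2"
    using \<open>d > 0\<close> by (intro eventually_at_rightI[of 0 "d / 2"]) simp_all
  then show "\<forall>\<^sub>F r in at_right 0.
      dist ((f (x + r *\<^sub>R u + r *\<^sub>R v) - f (x + r *\<^sub>R u) - f (x + r *\<^sub>R v) + f x) / r\<^sup>2) (?H x) < e"
  proof eventually_elim
    case (elim r)
    then obtain s t where "0 < s" "s < r" "0 < t" "t < r"
      and "f (x + r *\<^sub>R u + r *\<^sub>R v) - f (x + r *\<^sub>R u) - f (x + r *\<^sub>R v) + f x =
        r\<^sup>2 * ?H (x + s *\<^sub>R u + t *\<^sub>R v)"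
      using mixed_difference_mean_value[OF f S(1), of r x u v] near by metis
    then show ?case
      using near[of s r t] elim by simp
  qed
qed

lemma directional_deriv_commute:
  fixes f :: "'a::real_normed_vector \<Rightarrow> real"
  assumes "times_differentiable_on 2 S f" and "open S" "x \<in> S"
  shows "directional_deriv u (directional_deriv v f) x = directional_deriv v (directional_deriv u f) x"
  using mixed_difference_quotient_tendsto[OF assms, of u v]
    mixed_difference_quotient_tendsto[OF assms, of v u]
  by (auto simp: algebra_simps intro: tendsto_unique[OF trivial_limit_at_right_real])

lemma second_directional_deriv_diff_direction:
  fixes f :: "'a::real_normed_vector \<Rightarrow> real"
  assumes f: "times_differentiable_on 2 S f" and S: "open S" "x \<in> S"
  shows "directional_deriv (u - v) (directional_deriv (u - v) f) x =
    directional_deriv u (directional_deriv u f) x - 2 * directional_deriv u (directional_deriv v f) x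
    + directional_deriv v (directional_deriv v f) x"
proof -
  note diff = directional_deriv_diff_direction[OF times_differentiable_on_2_imp(2)[OF f S]]
  have "directional_deriv (u - v) (directional_deriv (u - v) f) x =
      directional_deriv (u - v) (directional_deriv u f) x
      - directional_deriv (u - v) (directional_deriv v f) x"
    by (simp only: diff[of u v "u - v"] directional_deriv_commute[OF f S, of u "u - v"]
        directional_deriv_commute[OF f S, of v "u - v"])
  then show ?thesis
    by (simp add: diff directional_deriv_commute[OF f S, of v u])
qed

lemma deriv_deriv_along_curve:
  fixes f :: "'a::real_normed_vector \<Rightarrow> real"
  assumes f: "times_differentiable_on 2 S f" "open S" and T: "open T" "t \<in> T"
    and c: "\<And>s. s \<in> T \<Longrightarrow> c s \<in> S" "\<And>s. s \<in> T \<Longrightarrow> (c has_vector_derivative a s *\<^sub>R v) (at s)"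
    and a: "(a has_real_derivative a') (at t)"
  shows "deriv (deriv (\<lambda>s. f (c s))) t =
    a' * directional_deriv v f (c t) + (a t)\<^sup>2 * directional_deriv v (directional_deriv v f) (c t)"
proof (rule DERIV_imp_deriv)
  have first_deriv: "deriv (\<lambda>s. f (c s)) s = a s * directional_deriv v f (c s)" if "s \<in> T" for s
    using times_differentiable_on_2_imp(1)[OF f c(1)[OF that]] c(2)[OF that]
    by (intro DERIV_imp_deriv has_real_derivative_along_curve)
  have "((\<lambda>s. directional_deriv v f (c s)) has_real_derivative
      a t * directional_deriv v (directional_deriv v f) (c t)) (at t)"
    using times_differentiable_on_2_imp(2)[OF f c(1)[OF T(2)]] c(2)[OF T(2)]
    by (rule has_real_derivative_along_curve)
  from DERIV_mult[OF a this] have "((\<lambda>s. a s * directional_deriv v f (c s)) has_real_derivative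
      a' * directional_deriv v f (c t) + (a t)\<^sup>2 * directional_deriv v (directional_deriv v f) (c t)) (at t)"
    by (simp add: power2_eq_square algebra_simps)
  then show "(deriv (\<lambda>s. f (c s)) has_real_derivative
      a' * directional_deriv v f (c t) + (a t)\<^sup>2 * directional_deriv v (directional_deriv v f) (c t)) (at t)"
    by (rule has_field_derivative_transform_within_open[OF _ T]) (simp add: first_deriv)
qed

lemma has_real_derivative_inverse_sqrt_along_curve:
  fixes f :: "'a::real_normed_vector \<Rightarrow> real"
  assumes f: "f differentiable (at (c t))" "0 < f (c t)"
    and c: "(c has_vector_derivative sqrt (f (c t)) *\<^sub>R v) (at t)"
  shows "((\<lambda>s. 1 / sqrt (f (c s))) has_real_derivative
    - (1/2) * (1 / sqrt (f (c t)))\<^sup>2 * directional_deriv v f (c t)) (at t)"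
  using has_real_derivative_along_curve[OF f(1) c] f(2)
  by (auto intro!: derivative_eq_intros simp: field_simps power2_eq_square)

section \<open>Autonomous equations on the line\<close>

lemma DERIV_pos_imp_inverse:
  fixes G :: "real \<Rightarrow> real"
  assumes S: "open S" "is_interval S"
    and G: "\<And>y. y \<in> S \<Longrightarrow> (G has_real_derivative G' y) (at y)" "\<And>y. y \<in> S \<Longrightarrow> 0 < G' y"
  obtains x where "open (G ` S)" "is_interval (G ` S)" "\<And>y. y \<in> S \<Longrightarrow> x (G y) = y"
    "\<And>y. y \<in> S \<Longrightarrow> (x has_real_derivative 1 / G' y) (at (G y))"
proof
  have "G y < G z" if "y \<in> S" "z \<in> S" "y < z" for y z
  proof (rule DERIV_pos_imp_increasing[OF \<open>y < z\<close>])
    fix w assume "y \<le> w" "w \<le> z"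
    then have "w \<in> S"
      using S(2) that by (meson mem_is_interval_1_I)
    then show "\<exists>D. (G has_real_derivative D) (at w) \<and> 0 < D"
      using G by blast
  qed
  then have inj: "inj_on G S"
    by (metis inj_onI linorder_neqE less_irrefl)
  have cont: "continuous_on S G"
    using G(1) by (meson DERIV_isCont continuous_at_imp_continuous_on)
  show "open (G ` S)"
    by (rule invariance_of_domain[OF cont \<open>open S\<close> inj])
  show "is_interval (G ` S)"
    using connected_continuous_image[OF cont] S(2) by (simp add: is_interval_connected_1)
  show inv: "the_inv_into S G (G y) = y" if "y \<in> S" for y
    using that inj by (simp add: the_inv_into_f_f)
  show "(the_inv_into S G has_real_derivative 1 / G' y) (at (G y))" if "y \<in> S" for y
    unfolding has_field_derivative_def
  proof (rule has_derivative_inverse_strong[OF \<open>open S\<close> that cont inv])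
    show "(G has_derivative (*) (G' y)) (at y)"
      using G(1)[OF that] by (simp add: has_field_derivative_def)
    show "(*) (G' y) \<circ> (*) (1 / G' y) = id"
      using G(2)[OF that] by (auto simp: fun_eq_iff)
  qed
qed

text \<open>Separation of variables: the solution inverts an antiderivative of \<open>1 / g\<close>.\<close>

lemma autonomous_ode_solution_exists:
  fixes g :: "real \<Rightarrow> real"
  assumes g: "continuous_on {a<..<b} g" "\<And>y. y \<in> {a<..<b} \<Longrightarrow> 0 < g y" and x0: "x0 \<in> {a<..<b}"
  obtains T t0 x where "open T" "is_interval T" "t0 \<in> T" "x t0 = x0"
    "\<And>t. t \<in> T \<Longrightarrow> x t \<in> {a<..<b}"
    "\<And>t. t \<in> T \<Longrightarrow> (x has_real_derivative g (x t)) (at t)"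
proof -
  have "isCont (\<lambda>y. 1 / g y) y" if "y \<in> {a<..<b}" for y
    using g(1) g(2)[OF that] that
    by (intro continuous_intros) (auto simp: continuous_on_eq_continuous_at)
  then obtain G where G: "\<And>y. y \<in> {a<..<b} \<Longrightarrow> (G has_real_derivative 1 / g y) (at y)"
    using einterval_antiderivative[of a b "\<lambda>y. 1 / g y"] x0
    by (auto simp: has_real_derivative_iff_has_vector_derivative)
  have "0 < 1 / g y" if "y \<in> {a<..<b}" for y
    using g(2)[OF that] by simp
  from DERIV_pos_imp_inverse[OF open_greaterThanLessThan is_interval_oo G this]
  obtain x where "open (G ` {a<..<b})" "is_interval (G ` {a<..<b})"
    and "\<And>y. y \<in> {a<..<b} \<Longrightarrow> x (G y) = y"
    and "\<And>y. y \<in> {a<..<b} \<Longrightarrow> (x has_real_derivative 1 / (1 / g y)) (at (G y))"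
    by blast
  then show thesis
    using x0 by (intro that[of "G ` {a<..<b}" "G x0" x]) (auto simp del: greaterThanLessThan_iff)
qed

section \<open>Edge weights\<close>

definition positive_orthant :: "(real, 'v::finite) vec set" where
  "positive_orthant = {q. \<forall>i. 0 < q $ i}"

lemma open_positive_orthant: "open (positive_orthant :: (real, 'v::finite) vec set)"
proof -
  have "open (\<Inter>i. {q :: (real, 'v) vec. 0 < q $ i})"
    by (intro open_INT finite ballI open_Collect_less continuous_intros)
  also have "(\<Inter>i. {q :: (real, 'v) vec. 0 < q $ i}) = positive_orthant"
    by (auto simp: positive_orthant_def)
  finally show ?thesis .
qed

lemma mem_positive_orthant_2: "q \<in> positive_orthant \<longleftrightarrow> 0 < q $ 1 \<and> 0 < q $ 2" for q :: "real ^ 2"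
  by (simp add: positive_orthant_def forall_2)

lemma smooth_on_imp_differentiable: "smooth_on S f \<Longrightarrow> x \<in> S \<Longrightarrow> f differentiable (at x)"
  unfolding smooth_on_def by (metis times_differentiable_on.simps(2))

lemma edge_weight_commute:
  assumes "weight_function \<theta>" "symp adj" "q \<in> positive_orthant"
  shows "edge_weight adj \<theta> j i q = edge_weight adj \<theta> i j q"
  using assms by (auto simp: edge_weight_def weight_function_def positive_orthant_def dest: sympD)

lemma edge_weight_pos:
  assumes "weight_function \<theta>" "adj i j" "i \<noteq> j" "q \<in> positive_orthant"
  shows "0 < edge_weight adj \<theta> i j q"
  using assms by (simp add: edge_weight_def weight_function_def positive_orthant_def)

lemma edge_weight_differentiable:
  assumes \<theta>: "weight_function \<theta>" and q: "q \<in> positive_orthant"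
  shows "edge_weight adj \<theta> i j differentiable (at q)"
proof (cases "i \<noteq> j \<and> adj i j")
  case True
  have "\<theta> differentiable (at (q $ i, q $ j))"
    using \<theta> q unfolding weight_function_def positive_orthant_def
    by (intro smooth_on_imp_differentiable[of "{0<..} \<times> {0<..}"]) auto
  moreover have "(\<lambda>q. (q $ i, q $ j)) differentiable (at q)"
    by (intro bounded_linear_imp_differentiable bounded_linear_Pair bounded_linear_vec_nth)
  ultimately show ?thesis
    using differentiable_chain_at[of "\<lambda>q. (q $ i, q $ j)" q \<theta>] True
    by (simp add: edge_weight_def[abs_def] o_def)
next
  case False
  then have "edge_weight adj \<theta> i j = (\<lambda>_. 0)"
    by (auto simp: edge_weight_def fun_eq_iff)
  then show ?thesis
    by simp
qed

lemma partial_deriv_edge_weight_commute: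
  assumes "weight_function \<theta>" "symp adj" "q \<in> positive_orthant"
  shows "partial_deriv k (edge_weight adj \<theta> j i) q = partial_deriv k (edge_weight adj \<theta> i j) q"
  unfolding partial_deriv_eq_directional_deriv using assms edge_weight_commute
  by (intro directional_deriv_cong_open[OF open_positive_orthant]) auto

lemma symp_K2_adj: "symp K2_adj"
  by (auto simp: K2_adj_def intro: sympI)

lemma K2_weight_diag [simp]: "K2_weight \<theta> i i = (\<lambda>_. 0)"
  by (simp add: K2_weight_def edge_weight_def fun_eq_iff)

lemmas K2_weight_commute = edge_weight_commute[OF _ symp_K2_adj, folded K2_weight_def]
  and partial_deriv_K2_weight_commute =
    partial_deriv_edge_weight_commute[OF _ symp_K2_adj, folded K2_weight_def]
  and K2_weight_differentiable = edge_weight_differentiable[where adj = K2_adj, folded K2_weight_def]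

lemma K2_weight_pos:
  assumes "weight_function \<theta>" "q \<in> positive_orthant"
  shows "0 < K2_weight \<theta> 1 2 q"
  using assms edge_weight_pos[of \<theta> K2_adj 1 2 q] by (simp add: K2_weight_def K2_adj_def)

section \<open>Geodesics on \<open>K\<^sub>2\<close>\<close>

definition K2_edge :: "real ^ 2" where
  "K2_edge = axis 1 1 - axis 2 1"

lemma K2_edge_nth [simp]: "K2_edge $ 1 = 1" "K2_edge $ 2 = - 1"
  by (simp_all add: K2_edge_def axis_def)

lemma directional_deriv_K2_edge:
  assumes "f differentiable (at q)"
  shows "directional_deriv K2_edge f q = partial_deriv 1 f q - partial_deriv 2 f q"
  using assms
  by (simp add: K2_edge_def partial_deriv_eq_directional_deriv directional_deriv_diff_direction)

text \<open>In the library's linear order on the type \<open>2\<close>, the vertex 2 is the zero element, so 2 < 1.\<close>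

lemma less_K2_vertices_iff: "i < j \<longleftrightarrow> i = 2 \<and> j = 1" for i j :: 2
proof -
  have "(0::2) < 1"
    by (simp add: less_bit0_def bit0.Rep_0 bit0.Rep_1)
  moreover have "(2::2) = 0" by simp
  ultimately have "(2::2) < 1" by metis
  then show ?thesis
    using exhaust_2[of i] exhaust_2[of j] by (elim disjE) auto
qed

lemma Gamma1_K2:
  assumes "weight_function \<theta>" "q \<in> positive_orthant"
  shows "Gamma1 (K2_weight \<theta>) q f g = K2_weight \<theta> 1 2 q * (f $ 1 - f $ 2) * (g $ 1 - g $ 2)"
proof -
  have "{(i, j). i < (j::2)} = {(2, 1)}"
    by (auto simp: less_K2_vertices_iff)
  then show ?thesis
    using K2_weight_commute[OF assms, of 1 2] by (simp add: Gamma1_def algebra_simps)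
qed

lemma Gamma1_K2_gradient:
  assumes "weight_function \<theta>" "q \<in> positive_orthant" "E differentiable (at q)"
  shows "Gamma1 (K2_weight \<theta>) q (gradient E q) h =
    K2_weight \<theta> 1 2 q * directional_deriv K2_edge E q * (h $ 1 - h $ 2)"
  using assms by (simp add: Gamma1_K2 gradient_def directional_deriv_K2_edge)

lemma geodesic_on_K2_iff:
  assumes \<theta>: "weight_function \<theta>"
  shows "geodesic_on (K2_weight \<theta>) T p f h \<longleftrightarrow> open T \<and> is_interval T \<and>
    (\<forall>t\<in>T. p t \<in> positive_orthant \<and>
      (p has_vector_derivative ((f t $ 1 - f t $ 2) * K2_weight \<theta> 1 2 (p t)) *\<^sub>R K2_edge) (at t) \<and>
      (f has_vector_derivative (\<chi> i. - (1/2) * (f t $ 1 - f t $ 2)\<^sup>2 *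
         partial_deriv i (K2_weight \<theta> 1 2) (p t) + h t $ i)) (at t))"
proof -
  have "(\<chi> i. \<Sum>j\<in>UNIV. (f t $ i - f t $ j) * K2_weight \<theta> i j (p t)) =
      ((f t $ 1 - f t $ 2) * K2_weight \<theta> 1 2 (p t)) *\<^sub>R K2_edge"
    and "(\<chi> i. - (1/2) * (\<Sum>j\<in>UNIV. (f t $ i - f t $ j)\<^sup>2 * partial_deriv i (K2_weight \<theta> i j) (p t))
        + h t $ i) =
      (\<chi> i. - (1/2) * (f t $ 1 - f t $ 2)\<^sup>2 * partial_deriv i (K2_weight \<theta> 1 2) (p t) + h t $ i)"
    if "p t \<in> positive_orthant" for t
    using K2_weight_commute[OF \<theta> that, of 2 1] partial_deriv_K2_weight_commute[OF \<theta> that, of _ 2 1]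
    by (simp_all add: vec_eq_iff forall_2 sum_2 power2_commute[of "f t $ 2"] algebra_simps)
  then show ?thesis
    unfolding geodesic_on_def positive_orthant_def by auto
qed

lemma K2_geodesic_flux_derivative:
  assumes \<theta>: "weight_function \<theta>" and geodesic: "geodesic_on (K2_weight \<theta>) T p f h" and t: "t \<in> T"
  shows "((\<lambda>t. (f t $ 1 - f t $ 2) * K2_weight \<theta> 1 2 (p t)) has_real_derivative
    1/2 * (f t $ 1 - f t $ 2)\<^sup>2 * K2_weight \<theta> 1 2 (p t) * directional_deriv K2_edge (K2_weight \<theta> 1 2) (p t)
    + (h t $ 1 - h t $ 2) * K2_weight \<theta> 1 2 (p t)) (at t)"
proof -
  define w where "w = K2_weight \<theta> 1 2"
  let ?u = "\<lambda>t. f t $ 1 - f t $ 2" and ?Dw = "directional_deriv K2_edge w (p t)"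
  have pos: "p t \<in> positive_orthant"
    and p': "(p has_vector_derivative (?u t * w (p t)) *\<^sub>R K2_edge) (at t)"
    and f': "(f has_vector_derivative (\<chi> i. - (1/2) * (?u t)\<^sup>2 * partial_deriv i w (p t) + h t $ i)) (at t)"
    using geodesic t unfolding geodesic_on_K2_iff[OF \<theta>] w_def by blast+
  have w: "w differentiable (at (p t))"
    using K2_weight_differentiable[OF \<theta> pos] by (simp add: w_def)
  have component': "((\<lambda>t. f t $ i) has_real_derivative
      - (1/2) * (?u t)\<^sup>2 * partial_deriv i w (p t) + h t $ i) (at t)" for i
    using bounded_linear.has_vector_derivative[OF bounded_linear_vec_nth f', of i]
    by (simp add: has_real_derivative_iff_has_vector_derivative)
  have u': "(?u has_real_derivative - (1/2) * (?u t)\<^sup>2 * ?Dw + (h t $ 1 - h t $ 2)) (at t)"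
    by (rule DERIV_cong[OF DERIV_diff[OF component'[of 1] component'[of 2]]])
      (simp add: directional_deriv_K2_edge[OF w] field_simps)
  have w': "((\<lambda>t. w (p t)) has_real_derivative ?u t * w (p t) * ?Dw) (at t)"
    using w p' by (rule has_real_derivative_along_curve)
  show ?thesis
    using DERIV_mult[OF u' w'] by (simp add: w_def algebra_simps power2_eq_square)
qed

definition K2_curvature :: "(real \<times> real \<Rightarrow> real) \<Rightarrow> (real ^ 2 \<Rightarrow> real) \<Rightarrow> real ^ 2 \<Rightarrow> real" where
  "K2_curvature \<theta> E q =
     1/2 * directional_deriv K2_edge (K2_weight \<theta> 1 2) q * directional_deriv K2_edge E q
     + K2_weight \<theta> 1 2 q * directional_deriv K2_edge (directional_deriv K2_edge E) q"

lemma K2_curvature_eq_partial_derivs: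
  assumes \<theta>: "weight_function \<theta>"
    and E: "times_differentiable_on 2 positive_orthant E" and q: "q \<in> positive_orthant"
  shows "K2_curvature \<theta> E q =
    1/2 * (partial_deriv 1 (K2_weight \<theta> 1 2) q - partial_deriv 2 (K2_weight \<theta> 1 2) q)
        * (partial_deriv 1 E q - partial_deriv 2 E q)
    + K2_weight \<theta> 1 2 q * (partial_deriv 1 (partial_deriv 1 E) q
        - 2 * partial_deriv 1 (partial_deriv 2 E) q + partial_deriv 2 (partial_deriv 2 E) q)"
proof -
  have "directional_deriv K2_edge (directional_deriv K2_edge E) q =
      partial_deriv 1 (partial_deriv 1 E) q - 2 * partial_deriv 1 (partial_deriv 2 E) q
      + partial_deriv 2 (partial_deriv 2 E) q"
    unfolding K2_edge_def partial_deriv_eq_directional_deriv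
    by (rule second_directional_deriv_diff_direction[OF E open_positive_orthant q])
  then show ?thesis
    using times_differentiable_on_2_imp(1)[OF E open_positive_orthant q] K2_weight_differentiable[OF \<theta> q]
    by (simp add: K2_curvature_def directional_deriv_K2_edge)
qed

lemma Gamma2_K2:
  assumes \<theta>: "weight_function \<theta>" and E: "times_differentiable_on 2 positive_orthant E"
    and geodesic: "geodesic_on (K2_weight \<theta>) T p f h"
    and orth: "orthogonal_force_on (K2_weight \<theta>) E T p f h" and t: "t \<in> T"
  shows "Gamma2 E p t = K2_curvature \<theta> E (p t) * Gamma1 (K2_weight \<theta>) (p t) (f t) (f t)"
proof -
  define w where "w = K2_weight \<theta> 1 2"
  let ?D = "directional_deriv K2_edge" and ?u = "f t $ 1 - f t $ 2"
  have T: "open T" and pos: "\<And>s. s \<in> T \<Longrightarrow> p s \<in> positive_orthant"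
    and p': "\<And>s. s \<in> T \<Longrightarrow>
      (p has_vector_derivative ((f s $ 1 - f s $ 2) * w (p s)) *\<^sub>R K2_edge) (at s)"
    using geodesic unfolding geodesic_on_K2_iff[OF \<theta>] w_def by blast+
  have "E differentiable (at (p t))"
    by (rule times_differentiable_on_2_imp(1)[OF E open_positive_orthant pos[OF t]])
  from Gamma1_K2_gradient[OF \<theta> pos[OF t] this, of "h t"]
  have force: "w (p t) * ?D E (p t) * (h t $ 1 - h t $ 2) = 0"
    using orth t by (simp add: orthogonal_force_on_def w_def)
  have "Gamma2 E p t =
      (1/2 * ?u\<^sup>2 * w (p t) * ?D w (p t) + (h t $ 1 - h t $ 2) * w (p t)) * ?D E (p t)
      + (?u * w (p t))\<^sup>2 * ?D (?D E) (p t)"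
    unfolding Gamma2_def
    using deriv_deriv_along_curve[OF E open_positive_orthant T t pos p'
        K2_geodesic_flux_derivative[OF \<theta> geodesic t, folded w_def]] .
  also have "\<dots> = K2_curvature \<theta> E (p t) * (w (p t) * ?u * ?u)
      + w (p t) * ?D E (p t) * (h t $ 1 - h t $ 2)"
    by (simp add: K2_curvature_def w_def power2_eq_square algebra_simps)
  finally show ?thesis
    using force by (simp add: Gamma1_K2[OF \<theta> pos[OF t]] w_def)
qed

text \<open>
  Unit speed forces \<open>f\<^sub>1 - f\<^sub>2 = 1 / sqrt \<theta>\<^sub>1\<^sub>2(p)\<close>. Only this difference matters, so the mean of
  \<open>f\<close> is kept at 0 by a force with \<open>h\<^sub>1 = h\<^sub>2\<close>.
\<close>

lemma K2_geodesic_along_unit_speed_curve: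
  assumes \<theta>: "weight_function \<theta>" and T: "open T" "is_interval T"
    and pos: "\<And>t. t \<in> T \<Longrightarrow> p t \<in> positive_orthant"
    and p': "\<And>t. t \<in> T \<Longrightarrow> (p has_vector_derivative sqrt (K2_weight \<theta> 1 2 (p t)) *\<^sub>R K2_edge) (at t)"
  obtains f h where "geodesic_on (K2_weight \<theta>) T p f h" "orthogonal_force_on (K2_weight \<theta>) E T p f h"
    "\<And>t. t \<in> T \<Longrightarrow> Gamma1 (K2_weight \<theta>) (p t) (f t) (f t) = 1"
proof
  define w where "w = K2_weight \<theta> 1 2"
  define u where "u t = 1 / sqrt (w (p t))" for t
  define f where "f t = (u t / 2) *\<^sub>R K2_edge" for t
  define h :: "real \<Rightarrow> real ^ 2" where
    "h t = (\<chi> i. (u t)\<^sup>2 / 4 * (partial_deriv 1 w (p t) + partial_deriv 2 w (p t)))" for t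
  have f_diff: "f t $ 1 - f t $ 2 = u t" for t
    by (simp add: f_def)
  have w_pos: "0 < w (p t)" if "t \<in> T" for t
    using K2_weight_pos[OF \<theta> pos[OF that]] by (simp add: w_def)
  have u_w: "u t * w (p t) = sqrt (w (p t))" if "t \<in> T" for t
    using w_pos[OF that] by (simp add: u_def real_div_sqrt)
  have f': "(f has_vector_derivative (\<chi> i. - (1/2) * (u t)\<^sup>2 * partial_deriv i w (p t) + h t $ i)) (at t)"
    if t: "t \<in> T" for t
  proof -
    have w: "w differentiable (at (p t))"
      using K2_weight_differentiable[OF \<theta> pos[OF t]] by (simp add: w_def)
    have "(u has_real_derivative - (1/2) * (u t)\<^sup>2 * directional_deriv K2_edge w (p t)) (at t)"
      unfolding u_def using w w_pos[OF t] p'[OF t, folded w_def]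
      by (rule has_real_derivative_inverse_sqrt_along_curve)
    from DERIV_cdivide[OF this, of 2]
    have "((\<lambda>t. u t / 2) has_real_derivative
        - (1/4) * (u t)\<^sup>2 * directional_deriv K2_edge w (p t)) (at t)"
      by simp
    then have "(f has_vector_derivative
        (- (1/4) * (u t)\<^sup>2 * directional_deriv K2_edge w (p t)) *\<^sub>R K2_edge) (at t)"
      unfolding f_def has_real_derivative_iff_has_vector_derivative
      by (rule bounded_linear.has_vector_derivative[OF bounded_linear_scaleR_left])
    also have "(- (1/4) * (u t)\<^sup>2 * directional_deriv K2_edge w (p t)) *\<^sub>R K2_edge =
        (\<chi> i. - (1/2) * (u t)\<^sup>2 * partial_deriv i w (p t) + h t $ i)"
      by (simp add: vec_eq_iff forall_2 h_def directional_deriv_K2_edge[OF w] field_simps)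
    finally show ?thesis .
  qed
  show "geodesic_on (K2_weight \<theta>) T p f h"
    unfolding geodesic_on_K2_iff[OF \<theta>] f_diff using T pos p' f' u_w by (simp add: w_def)
  show "orthogonal_force_on (K2_weight \<theta>) E T p f h"
    using pos by (simp add: orthogonal_force_on_def Gamma1_K2[OF \<theta>] h_def)
  show "Gamma1 (K2_weight \<theta>) (p t) (f t) (f t) = 1" if "t \<in> T" for t
    using w_pos[OF that] by (simp add: Gamma1_K2[OF \<theta> pos[OF that]] f_diff u_def flip: w_def)
qed

lemma K2_unit_speed_geodesic_exists:
  assumes \<theta>: "weight_function \<theta>" and q: "q \<in> positive_orthant"
  obtains T p f h t where "geodesic_on (K2_weight \<theta>) T p f h"
    "orthogonal_force_on (K2_weight \<theta>) E T p f h" "t \<in> T" "p t = q"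
    "\<And>s. s \<in> T \<Longrightarrow> Gamma1 (K2_weight \<theta>) (p s) (f s) (f s) = 1"
proof -
  define w where "w = K2_weight \<theta> 1 2"
  define c where "c y = q + y *\<^sub>R K2_edge" for y
  define g where "g y = sqrt (w (c y))" for y
  let ?I = "{- q $ 1<..<q $ 2}"
  have c_pos: "c y \<in> positive_orthant" if "y \<in> ?I" for y
    using that by (auto simp: c_def mem_positive_orthant_2)
  have c': "(c has_vector_derivative K2_edge) (at y)" for y
    unfolding c_def by (rule has_vector_derivative_line)
  have "isCont (\<lambda>y. w (c y)) y" if "y \<in> ?I" for y
    using has_real_derivative_along_line[of w q y K2_edge] K2_weight_differentiable[OF \<theta> c_pos[OF that]]
    by (auto simp: w_def c_def intro: DERIV_isCont)
  then have g_cont: "continuous_on ?I g"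
    unfolding g_def by (intro continuous_on_real_sqrt continuous_at_imp_continuous_on) blast
  have g_pos: "0 < g y" if "y \<in> ?I" for y
    using K2_weight_pos[OF \<theta> c_pos[OF that]] by (simp add: g_def w_def)
  have "0 \<in> ?I"
    using q by (simp add: mem_positive_orthant_2)
  from autonomous_ode_solution_exists[OF g_cont g_pos this]
  obtain T t0 x where T: "open T" "is_interval T" "t0 \<in> T" "x t0 = 0"
    and x: "\<And>t. t \<in> T \<Longrightarrow> x t \<in> ?I" "\<And>t. t \<in> T \<Longrightarrow> (x has_real_derivative g (x t)) (at t)"
    by blast
  have "((\<lambda>t. c (x t)) has_vector_derivative sqrt (w (c (x t))) *\<^sub>R K2_edge) (at t)" if "t \<in> T" for t
    using vector_diff_chain_at[OF x(2)[OF that, unfolded has_real_derivative_iff_has_vector_derivative] c']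
    by (simp add: o_def g_def)
  then obtain f h where "geodesic_on (K2_weight \<theta>) T (\<lambda>t. c (x t)) f h"
    "orthogonal_force_on (K2_weight \<theta>) E T (\<lambda>t. c (x t)) f h"
    "\<And>t. t \<in> T \<Longrightarrow> Gamma1 (K2_weight \<theta>) (c (x t)) (f t) (f t) = 1"
    using K2_geodesic_along_unit_speed_curve[OF \<theta> T(1,2), of "\<lambda>t. c (x t)" E] c_pos[OF x(1)]
    unfolding w_def by blast
  moreover have "c (x t0) = q"
    by (simp add: T c_def)
  ultimately show thesis
    using that T(3) by blast
qed

section \<open>The local Ricci curvature bound\<close>

lemma is_local_ricci_boundI_eq:
  assumes Gamma2: "\<And>T p f h t. geodesic_on W T p f h \<Longrightarrow> orthogonal_force_on W E T p f h \<Longrightarrow>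
      t \<in> T \<Longrightarrow> p t = q \<Longrightarrow> Gamma2 E p t = \<kappa> * Gamma1 W q (f t) (f t)"
    and geodesic: "geodesic_on W T p f h" "constant_speed_on W T p f" "orthogonal_force_on W E T p f h"
    and t: "t \<in> T" "p t = q" "0 < Gamma1 W q (f t) (f t)"
  shows "is_local_ricci_bound W E q \<kappa>"
  unfolding is_local_ricci_bound_def
proof (intro conjI allI impI)
  show "ricci_lower_bound W E q \<kappa>"
    unfolding ricci_lower_bound_def by (simp add: Gamma2)
  fix k assume "ricci_lower_bound W E q k"
  then have "k * Gamma1 W q (f t) (f t) \<le> Gamma2 E p t"
    using geodesic t(1,2) unfolding ricci_lower_bound_def by blast
  then show "k \<le> \<kappa>"
    using Gamma2[OF geodesic(1,3) t(1,2)] t(3) by simp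
qed

lemma is_local_ricci_bound_K2:
  assumes \<theta>: "weight_function \<theta>"
    and E: "times_differentiable_on 2 positive_orthant E" and q: "q \<in> positive_orthant"
  shows "is_local_ricci_bound (K2_weight \<theta>) E q (K2_curvature \<theta> E q)"
proof -
  let ?W = "K2_weight \<theta>"
  obtain T p f h t where geodesic: "geodesic_on ?W T p f h" "orthogonal_force_on ?W E T p f h"
    and t: "t \<in> T" "p t = q" and unit: "\<And>s. s \<in> T \<Longrightarrow> Gamma1 ?W (p s) (f s) (f s) = 1"
    using K2_unit_speed_geodesic_exists[OF \<theta> q] by metis
  have "constant_speed_on ?W T p f"
    using unit by (simp add: constant_speed_on_def)
  then show ?thesis
    using geodesic t unit[OF t(1)] Gamma2_K2[OF \<theta> E]
    by (intro is_local_ricci_boundI_eq[of ?W E q _ T p f h t]) auto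
qed

theorem mainTheorem5:
  fixes \<theta> :: "real \<times> real \<Rightarrow> real"
    and E :: "real ^ 2 \<Rightarrow> real"
    and p :: "real ^ 2"
  assumes "weight_function \<theta>"
    and "smooth_on {q. 0 < q $ 1 \<and> 0 < q $ 2} E"
    and "0 < p $ 1" and "0 < p $ 2" and "p $ 1 + p $ 2 = 1"
  shows "is_local_ricci_bound (K2_weight \<theta>) E p
    (1/2 * (partial_deriv 1 (K2_weight \<theta> 1 2) p - partial_deriv 2 (K2_weight \<theta> 1 2) p)
         * (partial_deriv 1 E p - partial_deriv 2 E p)
     + K2_weight \<theta> 1 2 p * (partial_deriv 1 (partial_deriv 1 E) p
         - 2 * partial_deriv 1 (partial_deriv 2 E) p
         + partial_deriv 2 (partial_deriv 2 E) p))"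
proof -
  have p: "p \<in> positive_orthant"
    using assms(3,4) by (simp add: mem_positive_orthant_2)
  have "{q :: real ^ 2. 0 < q $ 1 \<and> 0 < q $ 2} = positive_orthant"
    by (auto simp: mem_positive_orthant_2)
  then have E: "times_differentiable_on 2 positive_orthant E"
    using assms(2) by (simp add: smooth_on_def)
  show ?thesis
    using is_local_ricci_bound_K2[OF assms(1) E p]
    by (simp only: K2_curvature_eq_partial_derivs[OF assms(1) E p])
qed

end
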